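(* Let $\Sigma=E_1+\cdots+E_m$ be the Minkowski sum of the solid ellipsoids $E_i=\{A_i\mathbf v:\ \mathbf v\in\mathbb{R}^N,\ \|\mathbf v\|<1\}$, $i=1,\dots,m$, where each $A_i$ is a symmetric positive-definite $N\times N$ real matrix. For $\mathbf n\in\mathbb{S}^{N-1}$ let $$C(\Sigma,\mathbf n):=\sum_{i=1}^m\left[\frac{A_i^2}{\|A_i\mathbf n\|}-\frac{A_i^2\mathbf n\mathbf n^TA_i^2}{\|A_i\mathbf n\|^3}\right].$$ Then, for every $\mathbf n\in\mathbb{S}^{N-1}$, the matrix $C(\Sigma,\mathbf n)$ is positive semidefinite of rank $N-1$, and the principal curvatures of $\partial\Sigma$ at the point $$\mathbf x_{\partial\Sigma}(\mathbf n)=\sum_{i=1}^m\frac{A_i^2\mathbf n}{\|A_i\mathbf n\|}\in\partial\Sigma$$ are the reciprocals of the positive eigenvalues of $C(\Sigma,\mathbf n)$.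
   Context: $\|\cdot\|$ is the Euclidean norm, $\mathbb{S}^{N-1}$ is the unit sphere in $\mathbb{R}^N$, and vectors are columns. The Minkowski sum of sets is $B_1+B_2=\{\mathbf x+\mathbf y:\mathbf x\in B_1,\ \mathbf y\in B_2\}$. The map $\mathbf n\mapsto\mathbf x_{\partial\Sigma}(\mathbf n)$ parametrizes $\partial\Sigma$, with $\mathbf n$ the outward unit normal at $\mathbf x_{\partial\Sigma}(\mathbf n)$. Principal curvatures of the hypersurface $\partial\Sigma$ are the eigenvalues (with multiplicity) of $G^{-1}L$, where, in local coordinates $\phi_1,\dots,\phi_{N-1}$, $G=[g_{ij}]$ with $g_{ij}=\frac{\partial\mathbf x}{\partial\phi_i}\cdot\frac{\partial\mathbf x}{\partial\phi_j}$ is the metric tensor and $L=[l_{ij}]$ with $l_{ij}=\frac{\partial\mathbf n}{\partial\phi_i}\cdot\frac{\partial\mathbf x}{\partial\phi_j}=-\mathbf n\cdot\frac{\partial^2\mathbf x}{\partial\phi_i\partial\phi_j}$ is the second fundamental form, $\mathbf n$ being the outward unit normal (so the boundary of a ball of radius $r$ has principal curvatures $1/r>0$). *)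

theory Defs
  imports "HOL-Analysis.Analysis" "HOL-Computational_Algebra.Polynomial"
begin

section \<open>Matrices\<close>

definition positive_definite :: "real^'n^'n \<Rightarrow> bool" where
  "positive_definite A \<longleftrightarrow> transpose A = A \<and> (\<forall>v. v \<noteq> 0 \<longrightarrow> 0 < v \<bullet> (A *v v))"

definition positive_semidefinite :: "real^'n^'n \<Rightarrow> bool" where
  "positive_semidefinite A \<longleftrightarrow> transpose A = A \<and> (\<forall>v. 0 \<le> v \<bullet> (A *v v))"

definition charpoly :: "real^'n^'n \<Rightarrow> real poly" where
  "charpoly A = det (\<chi> i j. (if i = j then [:0, 1:] else 0) - [:A $ i $ j:])"

text \<open>Real eigenvalues with algebraic multiplicity. An equation between such multisets also
  records how many of the eigenvalues are real.\<close>

definition eigenvalues :: "real^'n^'n \<Rightarrow> real multiset" where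
  "eigenvalues A = proots (charpoly A)"


section \<open>Principal curvatures of the boundary of a set\<close>

definition partial :: "'k::finite \<Rightarrow> (real^'k \<Rightarrow> real^'n) \<Rightarrow> real^'k \<Rightarrow> real^'n" where
  "partial i x u = frechet_derivative x (at u) (axis i 1)"

definition C2_on :: "(real^'k) set \<Rightarrow> (real^'k \<Rightarrow> real^'n) \<Rightarrow> bool" where
  "C2_on U x \<longleftrightarrow>
     x differentiable_on U \<and>
     (\<forall>i. partial i x differentiable_on U) \<and>
     (\<forall>i j. continuous_on U (partial i (partial j x)))"

text \<open>Regular \<open>C\<^sup>2\<close> local coordinates \<open>x\<close>, defined on \<open>U\<close>, of the hypersurface \<open>M\<close>, in which
  the point \<open>p\<close> has coordinates \<open>u\<close>. The image is a neighbourhood of \<open>p\<close> relative to \<open>M\<close>.\<close>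

definition local_coordinates ::
  "(real^'n) set \<Rightarrow> real^'n \<Rightarrow> (real^'k) set \<Rightarrow> (real^'k \<Rightarrow> real^'n) \<Rightarrow> real^'k \<Rightarrow> bool" where
  "local_coordinates M p U x u \<longleftrightarrow>
     open U \<and> u \<in> U \<and> x u = p \<and>
     C2_on U x \<and> (\<forall>w\<in>U. inj (frechet_derivative x (at w))) \<and>
     openin (top_of_set M) (x ` U) \<and> (\<exists>y. homeomorphism U (x ` U) x y)"

definition outward_unit_normal ::
  "(real^'n) set \<Rightarrow> (real^'k \<Rightarrow> real^'n) \<Rightarrow> real^'k \<Rightarrow> real^'n \<Rightarrow> bool" where
  "outward_unit_normal S x u \<nu> \<longleftrightarrow>
     norm \<nu> = 1 \<and> (\<forall>i. \<nu> \<bullet> partial i x u = 0) \<and>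
     (\<forall>\<^sub>F t in at_right 0. x u + t *\<^sub>R \<nu> \<notin> closure S \<and> x u - t *\<^sub>R \<nu> \<in> S)"

definition metric_tensor :: "(real^'k \<Rightarrow> real^'n) \<Rightarrow> real^'k \<Rightarrow> real^'k^'k" where
  "metric_tensor x u = (\<chi> i j. partial i x u \<bullet> partial j x u)"

text \<open>With this sign the boundary of a ball of radius \<open>r\<close> has principal curvatures \<open>1 / r\<close> with
  respect to the outward normal. Differentiating \<open>\<nu> \<bullet> partial j x = 0\<close> for a normal field
  \<open>\<nu>\<close> shows that the entries are also \<open>partial i \<nu> u \<bullet> partial j x u\<close>.\<close>

definition second_fundamental_form ::
  "real^'n \<Rightarrow> (real^'k \<Rightarrow> real^'n) \<Rightarrow> real^'k \<Rightarrow> real^'k^'k" where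
  "second_fundamental_form \<nu> x u = (\<chi> i j. - (\<nu> \<bullet> partial i (partial j x) u))"

text \<open>Near \<open>p\<close> the boundary of \<open>S\<close> is a \<open>C\<^sup>2\<close> hypersurface, its outward unit normal at \<open>p\<close> is
  \<open>\<nu>\<close>, and its principal curvatures at \<open>p\<close>, computed in any local coordinates, form the
  multiset \<open>K\<close>. The coordinates range over \<open>real^'k\<close>, so this is meant for
  \<open>CARD('n) = CARD('k) + 1\<close>. The existence of local coordinates is part of the definition, which
  keeps the quantification over all of them from being vacuous.\<close>

definition has_principal_curvatures ::
  "'k::finite itself \<Rightarrow> (real^'n) set \<Rightarrow> real^'n \<Rightarrow> real^'n \<Rightarrow> real multiset \<Rightarrow> bool" where
  "has_principal_curvatures _ S p \<nu> K \<longleftrightarrow>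
     (\<exists>U (x :: real^'k \<Rightarrow> real^'n) u. local_coordinates (frontier S) p U x u) \<and>
     (\<forall>U (x :: real^'k \<Rightarrow> real^'n) u. local_coordinates (frontier S) p U x u \<longrightarrow>
        outward_unit_normal S x u \<nu> \<and>
        eigenvalues (matrix_inv (metric_tensor x u) ** second_fundamental_form \<nu> x u) = K)"


section \<open>Minkowski sums of ellipsoids\<close>

definition solid_ellipsoid :: "real^'n^'n \<Rightarrow> (real^'n) set" where
  "solid_ellipsoid A = {A *v v | v. norm v < 1}"

text \<open>Addition of sets, from \<open>HOL-Library.Set_Algebras\<close>, is the Minkowski sum.\<close>

definition ellipsoid_sum :: "(nat \<Rightarrow> real^'n^'n) \<Rightarrow> nat \<Rightarrow> (real^'n) set" where
  "ellipsoid_sum A m = (\<Sum>i\<in>{1..m}. solid_ellipsoid (A i))"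

text \<open>The powers of \<open>A i\<close> are matrix powers; the operation \<open>^\<close> on \<open>real^'n^'n\<close> is
  componentwise.\<close>

definition curvature_matrix :: "(nat \<Rightarrow> real^'n^'n) \<Rightarrow> nat \<Rightarrow> real^'n \<Rightarrow> real^'n^'n" where
  "curvature_matrix A m n = (\<Sum>i\<in>{1..m}.
     (1 / norm (A i *v n)) *\<^sub>R (A i ** A i)
     - (1 / norm (A i *v n) ^ 3) *\<^sub>R
       ((A i ** A i) ** (columnvector n :: real^1^'n) ** (rowvector n :: real^'n^1) ** (A i ** A i)))"

definition boundary_point :: "(nat \<Rightarrow> real^'n^'n) \<Rightarrow> nat \<Rightarrow> real^'n \<Rightarrow> real^'n" where
  "boundary_point A m n = (\<Sum>i\<in>{1..m}. (1 / norm (A i *v n)) *\<^sub>R ((A i ** A i) *v n))"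

end

theory Submission
  imports Defs
begin

text \<open>The sum \<open>\<Sigma>\<close> of the ellipsoids is described by its support function \<open>support y\<close>, the sum of the
  norms of \<open>A i *v y\<close>. Away from the origin it is smooth; its gradient at \<open>y\<close> is
  \<open>boundary_point A m y\<close> and its Hessian is \<open>curvature_matrix A m y\<close>
  (\<open>support_has_derivative\<close>, \<open>grad_has_derivative\<close>). Because a Cauchy--Schwarz inequality holds in
  every summand, the Hessian is positive semidefinite, and because \<open>A 1\<close> is injective its kernel is
  exactly the line through \<open>y\<close> (\<open>C_kernel\<close>), which gives the rank.

  On the closure of \<open>\<Sigma>\<close> the functional \<open>y\<close> is bounded by \<open>support y\<close>, and the gradient at \<open>y\<close> is the
  only point where the bound is attained (\<open>inner_le_support\<close>, \<open>eq_grad\<close>). With supporting hyperplanes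
  it follows that the gradient maps the unit sphere onto the frontier (\<open>grad_frontier\<close>,
  \<open>frontier_eq_grad\<close>), sending each \<open>y\<close> to the point with outward normal \<open>y\<close>. This map is injective,
  and its inverse, the Gauss map, is differentiable (\<open>gauss_map_exists\<close>).

  The Hessian at \<open>n\<close> is thus the derivative of the inverse of the Gauss map. The shape operator is
  the derivative of the Gauss map, hence on the tangent space it is the inverse of the Hessian, and
  its eigenvalues are the reciprocals of the positive eigenvalues of \<open>curvature_matrix A m n\<close>. To
  carry this out for arbitrary coordinates, both fundamental forms are written in an orthonormal
  eigenbasis of the Hessian, which the spectral theorem provides (\<open>normal_frame_exists\<close>,
  \<open>curvature_in_coordinates\<close>). One admissible coordinate system is the gradient composed with central
  projection from the tangent hyperplane to the sphere (\<open>local_coordinates_chart\<close>).\<close>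

section \<open>Orthonormal eigenbases of self-adjoint maps\<close>

text \<open>A maximiser \<open>v\<close> of \<open>x \<bullet> f x\<close> on the unit sphere of \<open>S\<close> is an eigenvector, and the maximum \<open>\<mu>\<close> is
  its eigenvalue: along any direction \<open>w \<in> S\<close> the quadratic \<open>x \<bullet> f x - \<mu> * (x \<bullet> x)\<close> stays
  nonpositive and vanishes at \<open>v\<close>, so its first-order term \<open>w \<bullet> (f v - \<mu> *\<^sub>R v)\<close> vanishes.\<close>

lemma self_adjoint_eigenvector:
  fixes f :: "'a::euclidean_space \<Rightarrow> 'a"
  assumes "linear f" and adj: "\<And>x y. x \<bullet> f y = f x \<bullet> y"
    and S: "subspace S" "f ` S \<subseteq> S" "S \<noteq> {0}"
  obtains v \<mu> where "v \<in> S" "norm v = 1" "f v = \<mu> *\<^sub>R v"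
proof -
  interpret linear f by fact
  let ?K = "S \<inter> sphere 0 1"
  obtain s where s: "s \<in> S" "s \<noteq> 0"
    using S subspace_0 by blast
  have "(1 / norm s) *\<^sub>R s \<in> ?K"
    using s S subspace_scale by auto
  then have "?K \<noteq> {}" by blast
  moreover have "compact ?K"
    using S closed_subspace by (intro closed_Int_compact) auto
  moreover have "continuous_on ?K (\<lambda>x. x \<bullet> f x)"
    using linear_continuous_on[OF linear_conv_bounded_linear[THEN iffD1, OF \<open>linear f\<close>]]
    by (intro continuous_intros)
  ultimately obtain v where v: "v \<in> ?K" "\<And>x. x \<in> ?K \<Longrightarrow> x \<bullet> f x \<le> v \<bullet> f v"
    using continuous_attains_sup[of ?K "\<lambda>x. x \<bullet> f x"] by blast
  define \<mu> where "\<mu> = v \<bullet> f v"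
  have vv: "v \<bullet> v = 1" using v by (simp add: dot_square_norm)
  have le: "x \<bullet> f x \<le> \<mu> * (x \<bullet> x)" if "x \<in> S" for x
  proof (cases "x = 0")
    case False
    let ?y = "(1 / norm x) *\<^sub>R x"
    have "?y \<in> ?K" using that S False subspace_scale by auto
    then have "?y \<bullet> f ?y \<le> \<mu>" using v \<mu>_def by blast
    then show ?thesis using False
      by (simp add: scale dot_square_norm field_simps power2_eq_square)
  qed (simp add: zero)
  have ort: "w \<bullet> (f v - \<mu> *\<^sub>R v) = 0" if "w \<in> S" for w
  proof -
    define \<beta> where "\<beta> = w \<bullet> (f v - \<mu> *\<^sub>R v)"
    let ?g = "\<lambda>t::real. (v + t *\<^sub>R w) \<bullet> f (v + t *\<^sub>R w) - \<mu> * ((v + t *\<^sub>R w) \<bullet> (v + t *\<^sub>R w))"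
    have eq: "?g = (\<lambda>t. t * (2 * \<beta>) + t\<^sup>2 * (w \<bullet> f w - \<mu> * (w \<bullet> w)))"
      using vv adj[of v w] adj[of w v] unfolding \<beta>_def \<mu>_def
      by (auto simp: add scale inner_simps algebra_simps power2_eq_square inner_commute fun_eq_iff)
    have "?g t \<le> 0" for t
      using le[of "v + t *\<^sub>R w"] v that S by (simp add: subspace_add subspace_scale)
    moreover have "(?g has_real_derivative 2 * \<beta>) (at 0)"
      unfolding eq by (auto intro!: derivative_eq_intros)
    moreover have "?g 0 = 0" using vv by (simp add: \<mu>_def)
    ultimately have "2 * \<beta> = 0"
      by (intro DERIV_local_max[of ?g "2 * \<beta>" 0 1]) auto
    then show ?thesis by (simp add: \<beta>_def)
  qed
  have "f v - \<mu> *\<^sub>R v \<in> S"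
    using v S by (auto intro!: subspace_diff subspace_scale)
  then have "f v = \<mu> *\<^sub>R v" using ort by fastforce
  then show ?thesis using that v by auto
qed

text \<open>The spectral theorem on an invariant subspace: split off one eigenvector and continue with its
  orthogonal complement, which is again invariant because the map is self-adjoint.\<close>

theorem self_adjoint_orthonormal_eigenbasis:
  fixes f :: "'a::euclidean_space \<Rightarrow> 'a"
  assumes f: "linear f" and adj: "\<And>x y. x \<bullet> f y = f x \<bullet> y"
    and S: "subspace S" "f ` S \<subseteq> S"
  shows "\<exists>B. B \<subseteq> S \<and> pairwise orthogonal B \<and> (\<forall>b\<in>B. norm b = 1 \<and> (\<exists>\<mu>. f b = \<mu> *\<^sub>R b))
    \<and> span B = S \<and> card B = dim S"
  using S
proof (induction "dim S" arbitrary: S rule: less_induct)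
  case less
  interpret linear f by fact
  show ?case
  proof (cases "S = {0}")
    case True
    then show ?thesis by (intro exI[of _ "{}"]) auto
  next
    case False
    obtain v \<mu> where v: "v \<in> S" "norm v = 1" "f v = \<mu> *\<^sub>R v"
      using self_adjoint_eigenvector[OF f adj less.prems False] by blast
    have vv: "v \<bullet> v = 1" using v by (simp add: dot_square_norm)
    define T where "T = S \<inter> {x. v \<bullet> x = 0}"
    have T: "subspace T"
      unfolding T_def using less.prems by (intro subspace_inter subspace_hyperplane)
    have "f ` T \<subseteq> T"
      using less.prems v by (auto simp: T_def adj)
    moreover have "T \<subset> S" using v vv unfolding T_def by force
    then have "dim T < dim S"
      using T less.prems by (intro dim_psubset) (simp add: span_eq_iff[THEN iffD2])
    ultimately obtain B where B: "B \<subseteq> T" "pairwise orthogonal B"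
      "\<forall>b\<in>B. norm b = 1 \<and> (\<exists>\<mu>. f b = \<mu> *\<^sub>R b)" "span B = T"
      using less.hyps[OF _ T] by blast
    let ?B = "insert v B"
    have BS: "?B \<subseteq> S" using B v by (auto simp: T_def)
    have po: "pairwise orthogonal ?B"
      using B by (auto simp: pairwise_insert T_def orthogonal_def inner_commute)
    have nB: "\<forall>b\<in>?B. norm b = 1 \<and> (\<exists>\<mu>. f b = \<mu> *\<^sub>R b)" using B v by auto
    have "x \<in> span ?B" if "x \<in> S" for x
    proof -
      have "x - (v \<bullet> x) *\<^sub>R v \<in> T"
        using that v vv less.prems by (auto simp: T_def inner_simps intro!: subspace_diff subspace_scale)
      then have "x - (v \<bullet> x) *\<^sub>R v \<in> span ?B" using B span_mono[of B ?B] by auto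
      then show ?thesis
        by (metis span_base span_scale insertI1 span_add_eq2 diff_add_cancel)
    qed
    then have sp: "span ?B = S"
      using BS less.prems span_minimal by blast
    have "independent ?B"
      using pairwise_orthogonal_independent[OF po] nB by force
    then have "card ?B = dim S" using sp dim_span_eq_card_independent by metis
    then show ?thesis using BS po nB sp by blast
  qed
qed

section \<open>Eigenvalues of similar and of diagonal matrices\<close>

definition diagonal_matrix :: "('a \<Rightarrow> 'b::zero) \<Rightarrow> 'b^'a^'a" where
  "diagonal_matrix d = (\<chi> i j. if i = j then d i else 0)"

lemma diagonal_matrix_mult_nth: "(diagonal_matrix d ** M) $ i $ j = d i * (M $ i $ j :: real)"
proof -
  have "(diagonal_matrix d ** M) $ i $ j = (\<Sum>k\<in>UNIV. if i = k then d i * M $ k $ j else 0)"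
    unfolding matrix_matrix_mult_def diagonal_matrix_def vec_lambda_beta
    by (rule sum.cong) auto
  then show ?thesis by simp
qed

lemma mult_diagonal_matrix_nth: "(M ** diagonal_matrix d) $ i $ j = M $ i $ j * (d j :: real)"
proof -
  have "(M ** diagonal_matrix d) $ i $ j = (\<Sum>k\<in>UNIV. if k = j then M $ i $ k * d j else 0)"
    unfolding matrix_matrix_mult_def diagonal_matrix_def vec_lambda_beta
    by (rule sum.cong) auto
  then show ?thesis by simp
qed

text \<open>Turns identities of characteristic polynomials into identities of determinants of real
  matrices, since a real polynomial is determined by its values.\<close>

lemma poly_charpoly: "poly (charpoly M) t = det (mat t - M)"
proof -
  have h: "poly ((if i = j then [:0, 1:] else 0) - [:M $ i $ j:]) t = (mat t - M) $ i $ j" for i j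
    by (simp add: mat_def)
  show ?thesis
    unfolding charpoly_def det_def
    by (simp add: poly_sum poly_prod h del: poly_diff)
qed

text \<open>Similarity is stated without an inverse, so that it can be read off from a matrix of
  eigenvectors \<open>Q\<close> directly.\<close>

lemma charpoly_similar:
  fixes Q :: "real^'n^'n"
  assumes "invertible Q" "M ** Q = Q ** M'"
  shows "charpoly M = charpoly M'"
proof -
  have "det (mat t - M) = det (mat t - M')" for t
  proof -
    have "(mat t - M) ** Q = mat t ** Q - M ** Q" "Q ** (mat t - M') = Q ** mat t - Q ** M'"
      by (simp_all add: vec_eq_iff matrix_matrix_mult_def left_diff_distrib right_diff_distrib sum_subtractf)
    moreover have "mat t ** Q = Q ** mat t"
      using diagonal_matrix_mult_nth[of "\<lambda>_. t" Q] mult_diagonal_matrix_nth[of Q "\<lambda>_. t"]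
      by (simp add: vec_eq_iff diagonal_matrix_def mat_def)
    ultimately have "(mat t - M) ** Q = Q ** (mat t - M')" using assms(2) by simp
    then have "det (mat t - M) * det Q = det Q * det (mat t - M')" by (metis det_mul)
    then show ?thesis using assms(1) by (simp add: invertible_det_nz)
  qed
  then show ?thesis
    by (simp add: poly_charpoly flip: poly_eq_poly_eq_iff add: fun_eq_iff)
qed

lemma eigenvalues_diagonal_matrix:
  fixes d :: "'n::finite \<Rightarrow> real"
  shows "eigenvalues (diagonal_matrix d) = image_mset d (mset_set UNIV)"
proof -
  have "charpoly (diagonal_matrix d) = (\<Prod>i\<in>UNIV. [:- d i, 1:])"
    unfolding charpoly_def
    by (subst det_diagonal) (auto simp: diagonal_matrix_def)
  also have "proots \<dots> = (\<Sum>i\<in>UNIV. {#d i#})"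
    by (subst proots_prod) auto
  finally show ?thesis
    by (simp add: eigenvalues_def sum_unfold_sum_mset)
qed

lemma eigenvalues_orthonormal_eigenbasis:
  fixes M :: "real^'n^'n"
  assumes B: "pairwise orthogonal B" "\<And>b. b \<in> B \<Longrightarrow> norm b = 1" "card B = CARD('n)"
    and eig: "\<And>b. b \<in> B \<Longrightarrow> M *v b = \<mu> b *\<^sub>R b"
  shows "eigenvalues M = image_mset \<mu> (mset_set B)"
proof -
  have "finite B" using B(3) by (metis card_gt_0_iff zero_less_card_finite)
  then obtain b :: "'n \<Rightarrow> real^'n" where b: "bij_betw b UNIV B"
    using B(3) by (metis finite_same_card_bij finite)
  have bB: "b i \<in> B" for i using b bij_betwE by blast
  have on: "b i \<bullet> b j = (if i = j then 1 else 0)" for i j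
  proof (cases "i = j")
    case False
    then have "b i \<noteq> b j" using b by (auto simp: bij_betw_def inj_on_def)
    then show ?thesis using B(1) bB False by (auto simp: pairwise_def orthogonal_def)
  qed (use B(2) bB in \<open>simp add: dot_square_norm\<close>)
  define Q where "Q = (\<chi> r i. b i $ r)"
  have "transpose Q ** Q = mat 1"
    using on by (auto simp: Q_def transpose_def matrix_matrix_mult_def vec_eq_iff mat_def inner_vec_def)
  then have "invertible Q" by (simp add: invertible_left_inverse) blast
  moreover have "M ** Q = Q ** diagonal_matrix (\<mu> \<circ> b)"
  proof -
    have "(M ** Q) $ r $ i = (M *v b i) $ r" for r i
      by (simp add: Q_def matrix_matrix_mult_def matrix_vector_mult_def)
    moreover have "(Q ** diagonal_matrix (\<mu> \<circ> b)) $ r $ i = \<mu> (b i) * b i $ r" for r i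
      by (simp add: mult_diagonal_matrix_nth Q_def)
    ultimately show ?thesis by (simp add: vec_eq_iff eig[OF bB])
  qed
  ultimately have "eigenvalues M = eigenvalues (diagonal_matrix (\<mu> \<circ> b))"
    by (simp add: eigenvalues_def charpoly_similar)
  also have "\<dots> = image_mset \<mu> (image_mset b (mset_set UNIV))"
    by (simp add: eigenvalues_diagonal_matrix multiset.map_comp)
  also have "image_mset b (mset_set UNIV) = mset_set B"
    using b by (metis bij_betw_def image_mset_mset_set)
  finally show ?thesis .
qed

lemma
  assumes "invertible M"
  shows matrix_inv_right: "M ** matrix_inv M = mat 1" and matrix_inv_left: "matrix_inv M ** M = mat 1"
  using assms unfolding invertible_def matrix_inv_def by (metis (mono_tags, lifting) someI_ex)+

text \<open>If \<open>R\<close> holds the coordinates of the derivative of the unit normal in an orthonormal frame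
  that diagonalises the derivative of the inverse Gauss map, with diagonal \<open>d\<close>, then \<open>G\<close> and \<open>L\<close>
  are the two fundamental forms, and \<open>R\<close> conjugates \<open>matrix_inv G ** L\<close> to the diagonal matrix
  with entries \<open>inverse (d i)\<close>.\<close>

lemma eigenvalues_shape_operator:
  fixes R :: "real^'k^'k"
  assumes R: "invertible R" and d: "\<And>i. d i \<noteq> 0"
    and G: "G = transpose R ** diagonal_matrix (\<lambda>i. d i * d i) ** R"
    and L: "L = transpose R ** diagonal_matrix d ** R"
  shows "eigenvalues (matrix_inv G ** L) = image_mset (\<lambda>i. inverse (d i)) (mset_set UNIV)"
proof -
  let ?D = "diagonal_matrix (\<lambda>i. inverse (d i))"
  have dd: "diagonal_matrix (\<lambda>i. d i * d i) ** ?D = diagonal_matrix d"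
    using d by (simp add: vec_eq_iff diagonal_matrix_mult_nth) (simp add: diagonal_matrix_def)
  have "det G \<noteq> 0"
    unfolding G det_mul using R d
    by (subst det_diagonal[of "diagonal_matrix _"]) (auto simp: diagonal_matrix_def invertible_det_nz)
  then have G': "matrix_inv G ** G = mat 1" by (intro matrix_inv_left) (simp add: invertible_det_nz)
  have R': "R ** matrix_inv R = mat 1" using R by (simp add: matrix_inv_right)
  have "G ** (matrix_inv R ** ?D ** R) = transpose R ** diagonal_matrix (\<lambda>i. d i * d i) ** (R ** matrix_inv R) ** ?D ** R"
    unfolding G by (simp add: matrix_mul_assoc)
  also have "\<dots> = transpose R ** (diagonal_matrix (\<lambda>i. d i * d i) ** ?D) ** R"
    unfolding R' by (simp add: matrix_mul_assoc)
  finally have "L = G ** (matrix_inv R ** ?D ** R)" unfolding dd L ..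
  then have "matrix_inv G ** L = matrix_inv R ** ?D ** R"
    by (simp add: matrix_mul_assoc G')
  then have "R ** (matrix_inv G ** L) = ?D ** R"
    by (simp add: matrix_mul_assoc R')
  then have "charpoly ?D = charpoly (matrix_inv G ** L)"
    by (intro charpoly_similar[OF R]) simp
  then show ?thesis by (metis eigenvalues_def eigenvalues_diagonal_matrix)
qed


section \<open>Positive definite matrices and outer products\<close>

lemma positive_definite_inner:
  assumes "positive_definite A"
  shows "(A *v x) \<bullet> y = x \<bullet> (A *v y)"
  using assms unfolding positive_definite_def
  by (metis dot_lmul_matrix transpose_matrix_vector)

lemma positive_definite_eq_0_iff:
  assumes "positive_definite A"
  shows "A *v x = 0 \<longleftrightarrow> x = 0"
  using assms unfolding positive_definite_def
  by (metis inner_zero_right less_irrefl matrix_vector_mult_0_right)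

lemma positive_definite_invertible:
  assumes "positive_definite A"
  shows "invertible A"
  using positive_definite_eq_0_iff[OF assms]
  by (simp add: invertible_left_inverse matrix_left_invertible_ker)

lemma sum_matrix_vector_mult: "(\<Sum>i\<in>I. M i) *v x = (\<Sum>i\<in>I. M i *v x)"
  for M :: "'i \<Rightarrow> real^'n^'m"
  by (induction I rule: infinite_finite_induct) (auto simp: matrix_vector_mult_add_rdistrib)

lemma outer_product_mult: "((columnvector v :: real^1^'n) ** (rowvector w :: real^'m^1)) *v x = (w \<bullet> x) *\<^sub>R v"
  by (simp add: vec_eq_iff matrix_vector_mult_def matrix_matrix_mult_def columnvector_def
      rowvector_def inner_vec_def sum_distrib_left sum_distrib_right mult_ac)

text \<open>A short step from a point of the unit sphere, in a direction at an obtuse angle to the radius,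
  leads into the open ball: the linear term of the squared norm dominates.\<close>

lemma norm_minus_scaleR_less:
  fixes u w :: "'a::real_inner"
  assumes "norm u = 1" "0 < u \<bullet> w"
  shows "\<forall>\<^sub>F t in at_right 0. norm (u - t *\<^sub>R w) < 1"
proof (rule eventually_at_rightI)
  have pos: "0 < w \<bullet> w + 1" by (simp add: add_nonneg_pos)
  show "0 < 2 * (u \<bullet> w) / (w \<bullet> w + 1)" using assms pos by simp
  fix t assume t: "t \<in> {0<..<2 * (u \<bullet> w) / (w \<bullet> w + 1)}"
  then have "t * (w \<bullet> w) < 2 * (u \<bullet> w)" using pos by (auto simp: field_simps)
  then have "t * (t * (w \<bullet> w)) < t * (2 * (u \<bullet> w))" using t by simp
  moreover have "(norm (u - t *\<^sub>R w))\<^sup>2 = 1 - t * (2 * (u \<bullet> w)) + t * (t * (w \<bullet> w))"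
    using assms(1) unfolding power2_norm_eq_inner
    by (simp add: inner_simps inner_commute[of w u] norm_eq_1 algebra_simps)
  ultimately have "(norm (u - t *\<^sub>R w))\<^sup>2 < 1" by simp
  then show "norm (u - t *\<^sub>R w) < 1" by (simp add: abs_square_less_1)
qed

section \<open>The support function and its first three derivatives\<close>

locale ellipsoids =
  fixes A :: "nat \<Rightarrow> real^'n^'n" and m :: nat
  assumes m: "1 \<le> m"
    and pd: "\<And>i. i \<in> {1..m} \<Longrightarrow> positive_definite (A i)"
begin

abbreviation "\<Sigma> \<equiv> ellipsoid_sum A m"
abbreviation "grad \<equiv> boundary_point A m"
abbreviation "C \<equiv> curvature_matrix A m"

definition support :: "real^'n \<Rightarrow> real" where
  "support y = (\<Sum>i\<in>{1..m}. norm (A i *v y))"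

lemma one_mem: "1 \<in> {1..m}" using m by simp

lemma inner_A: "i \<in> {1..m} \<Longrightarrow> (A i *v x) \<bullet> y = x \<bullet> (A i *v y)"
  by (simp add: positive_definite_inner pd)

lemma A_pos: "i \<in> {1..m} \<Longrightarrow> y \<noteq> 0 \<Longrightarrow> 0 < norm (A i *v y)"
  using positive_definite_eq_0_iff[OF pd] by simp

lemma support_pos: "y \<noteq> 0 \<Longrightarrow> 0 < support y"
  unfolding support_def using one_mem by (intro sum_pos A_pos) auto

lemma grad_eq: "grad y = (\<Sum>i\<in>{1..m}. (1 / norm (A i *v y)) *\<^sub>R (A i *v (A i *v y)))"
  by (simp add: boundary_point_def matrix_vector_mul_assoc)

text \<open>The form in which the curvature matrix is used throughout: the rank-one part acts through an
  inner product.\<close>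

lemma C_mult: "C y *v x = (\<Sum>i\<in>{1..m}. (1 / norm (A i *v y)) *\<^sub>R (A i *v (A i *v x))
    - ((A i *v y) \<bullet> (A i *v x) / norm (A i *v y) ^ 3) *\<^sub>R (A i *v (A i *v y)))"
  unfolding curvature_matrix_def sum_matrix_vector_mult
proof (intro sum.cong refl)
  fix i assume i: "i \<in> {1..m}"
  have "((A i ** A i) ** (columnvector y :: real^1^'n) ** (rowvector y :: real^'n^1) ** (A i ** A i)) *v x
    = (A i ** A i) *v (((columnvector y :: real^1^'n) ** (rowvector y :: real^'n^1)) *v (A i *v (A i *v x)))"
    by (simp add: matrix_vector_mul_assoc matrix_mul_assoc)
  also have "\<dots> = (y \<bullet> (A i *v (A i *v x))) *\<^sub>R (A i *v (A i *v y))"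
    unfolding outer_product_mult by (simp add: matrix_vector_mult_scaleR matrix_vector_mul_assoc)
  finally show "((1 / norm (A i *v y)) *\<^sub>R (A i ** A i) - (1 / norm (A i *v y) ^ 3) *\<^sub>R
       (A i ** A i ** (columnvector y :: real^1^'n) ** (rowvector y :: real^'n^1) ** (A i ** A i))) *v x
    = (1 / norm (A i *v y)) *\<^sub>R (A i *v (A i *v x))
    - ((A i *v y) \<bullet> (A i *v x) / norm (A i *v y) ^ 3) *\<^sub>R (A i *v (A i *v y))"
    using i by (simp add: matrix_vector_mult_diff_rdistrib matrix_vector_mul_assoc inner_A
        flip: scaleR_matrix_vector_assoc)
qed

text \<open>Euler's identity for the support function, which is homogeneous of degree one.\<close>

lemma inner_grad: "y \<bullet> grad y = support y"
  unfolding grad_eq support_def inner_sum_right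
  by (intro sum.cong refl) (simp add: inner_A[symmetric] dot_square_norm power2_eq_square)

lemma inner_grad_le: "x \<bullet> grad y \<le> support x"
  unfolding grad_eq support_def inner_sum_right
proof (intro sum_mono)
  fix i assume i: "i \<in> {1..m}"
  show "x \<bullet> ((1 / norm (A i *v y)) *\<^sub>R (A i *v (A i *v y))) \<le> norm (A i *v x)"
    using norm_cauchy_schwarz[of "A i *v x" "A i *v y"]
    by (simp add: inner_A[OF i, symmetric] divide_le_eq)
qed

lemma norm_A_has_derivative:
  assumes "i \<in> {1..m}" "y \<noteq> 0"
  shows "((\<lambda>y. norm (A i *v y)) has_derivative
    (\<lambda>x. (A i *v y) \<bullet> (A i *v x) / norm (A i *v y))) (at y)"
proof -
  have "((\<lambda>y. norm (A i *v y)) has_derivative (\<lambda>x. (A i *v x) \<bullet> sgn (A i *v y))) (at y)"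
    using A_pos[OF assms]
    by (intro has_derivative_compose[where f="(*v) (A i)" and g=norm] has_derivative_norm
      bounded_linear_imp_has_derivative matrix_vector_mul_bounded_linear) auto
  then show ?thesis by (simp add: sgn_div_norm inner_commute divide_inverse mult_ac)
qed

lemmas A_has_derivative = bounded_linear.has_derivative[OF matrix_vector_mul_bounded_linear]

lemma support_has_derivative:
  assumes "y \<noteq> 0"
  shows "(support has_derivative (\<lambda>x. grad y \<bullet> x)) (at y)"
proof -
  have "((\<lambda>y. \<Sum>i\<in>{1..m}. norm (A i *v y)) has_derivative
    (\<lambda>x. \<Sum>i\<in>{1..m}. (A i *v y) \<bullet> (A i *v x) / norm (A i *v y))) (at y)"
    by (intro has_derivative_sum norm_A_has_derivative assms)
  moreover have "(\<Sum>i\<in>{1..m}. (A i *v y) \<bullet> (A i *v x) / norm (A i *v y)) = grad y \<bullet> x" for x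
    unfolding grad_eq inner_sum_left by (intro sum.cong refl) (simp add: inner_A)
  ultimately show ?thesis by (simp add: support_def[abs_def])
qed

lemma grad_has_derivative:
  assumes "y \<noteq> 0"
  shows "(grad has_derivative (\<lambda>x. C y *v x)) (at y)"
  unfolding C_mult grad_eq[abs_def]
proof (intro has_derivative_sum)
  fix i assume i: "i \<in> {1..m}"
  show "((\<lambda>y. (1 / norm (A i *v y)) *\<^sub>R (A i *v (A i *v y))) has_derivative
      (\<lambda>x. (1 / norm (A i *v y)) *\<^sub>R (A i *v (A i *v x))
    - ((A i *v y) \<bullet> (A i *v x) / norm (A i *v y) ^ 3) *\<^sub>R (A i *v (A i *v y)))) (at y)"
    using A_pos[OF i assms]
    by (auto intro!: derivative_eq_intros norm_A_has_derivative[OF i assms] A_has_derivative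
        simp: fun_eq_iff power3_eq_cube field_simps)
qed

text \<open>The derivative of \<open>C y *v c\<close> with respect to \<open>y\<close> in the direction \<open>x\<close>, in closed form so that its
  continuity in \<open>y\<close> is visible. This continuity is what the second partial derivatives of
  \<open>C\<^sup>2\<close> coordinates need.\<close>
definition C_derivative :: "real^'n \<Rightarrow> real^'n \<Rightarrow> real^'n \<Rightarrow> real^'n" where
  "C_derivative y c x = (\<Sum>i\<in>{1..m}.
     - ((A i *v y) \<bullet> (A i *v x) / norm (A i *v y) ^ 3) *\<^sub>R (A i *v (A i *v c))
     - (((A i *v x) \<bullet> (A i *v c) / norm (A i *v y) ^ 3)
        - 3 * ((A i *v y) \<bullet> (A i *v c)) * ((A i *v y) \<bullet> (A i *v x)) / norm (A i *v y) ^ 5) *\<^sub>R (A i *v (A i *v y))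
     - ((A i *v y) \<bullet> (A i *v c) / norm (A i *v y) ^ 3) *\<^sub>R (A i *v (A i *v x)))"

lemma C_mult_has_derivative:
  assumes "y \<noteq> 0"
  shows "((\<lambda>y. C y *v c) has_derivative C_derivative y c) (at y)"
  unfolding C_mult C_derivative_def[abs_def]
proof (intro has_derivative_sum)
  fix i assume i: "i \<in> {1..m}"
  show "((\<lambda>y. (1 / norm (A i *v y)) *\<^sub>R (A i *v (A i *v c))
    - ((A i *v y) \<bullet> (A i *v c) / norm (A i *v y) ^ 3) *\<^sub>R (A i *v (A i *v y))) has_derivative
     (\<lambda>x. - ((A i *v y) \<bullet> (A i *v x) / norm (A i *v y) ^ 3) *\<^sub>R (A i *v (A i *v c))
     - (((A i *v x) \<bullet> (A i *v c) / norm (A i *v y) ^ 3)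
        - 3 * ((A i *v y) \<bullet> (A i *v c)) * ((A i *v y) \<bullet> (A i *v x)) / norm (A i *v y) ^ 5) *\<^sub>R (A i *v (A i *v y))
     - ((A i *v y) \<bullet> (A i *v c) / norm (A i *v y) ^ 3) *\<^sub>R (A i *v (A i *v x)))) (at y)"
    apply ((rule derivative_eq_intros norm_A_has_derivative[OF i assms] A_has_derivative | use A_pos[OF i assms] in force)+)[1]
    apply (rule ext)
    using A_pos[OF i assms]
    apply (simp add: eval_nat_numeral field_simps scaleR_diff_left scaleR_add_left)
    done
qed

lemma continuous_on_C_derivative:
  assumes "continuous_on U y" "\<And>w. w \<in> U \<Longrightarrow> y w \<noteq> 0"
  shows "continuous_on U (\<lambda>w. C_derivative (y w) c x)"
  unfolding C_derivative_def using A_pos assms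
  by (intro continuous_intros bounded_linear.continuous_on[OF matrix_vector_mul_bounded_linear]) force+

lemma C_inner: "x \<bullet> (C y *v z) = (\<Sum>i\<in>{1..m}. ((A i *v x) \<bullet> (A i *v z)) / norm (A i *v y)
    - ((A i *v y) \<bullet> (A i *v x)) * ((A i *v y) \<bullet> (A i *v z)) / norm (A i *v y) ^ 3)"
  unfolding C_mult inner_sum_right
proof (intro sum.cong refl)
  fix i assume i: "i \<in> {1..m}"
  have "x \<bullet> (A i *v (A i *v w)) = (A i *v x) \<bullet> (A i *v w)" for w
    using i by (simp add: inner_A)
  then show "x \<bullet> ((1 / norm (A i *v y)) *\<^sub>R (A i *v (A i *v z))
      - ((A i *v y) \<bullet> (A i *v z) / norm (A i *v y) ^ 3) *\<^sub>R (A i *v (A i *v y)))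
    = ((A i *v x) \<bullet> (A i *v z)) / norm (A i *v y)
      - ((A i *v y) \<bullet> (A i *v x)) * ((A i *v y) \<bullet> (A i *v z)) / norm (A i *v y) ^ 3"
    by (simp add: inner_diff_right inner_commute[of "A i *v x" "A i *v y"])
qed

lemma C_inner_commute: "x \<bullet> (C y *v z) = (C y *v x) \<bullet> z"
  unfolding inner_commute[of "C y *v x"] C_inner
  by (intro sum.cong refl) (simp add: inner_commute mult_ac)

text \<open>This is the Cauchy--Schwarz inequality for \<open>A i *v y\<close> and \<open>A i *v x\<close>.\<close>

lemma C_quadratic_summand_nonneg:
  "0 \<le> ((A i *v x) \<bullet> (A i *v x)) / norm (A i *v y)
    - ((A i *v y) \<bullet> (A i *v x)) * ((A i *v y) \<bullet> (A i *v x)) / norm (A i *v y) ^ 3"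
proof (cases "A i *v y = 0")
  case False
  have "((A i *v y) \<bullet> (A i *v x))\<^sup>2 \<le> ((A i *v y) \<bullet> (A i *v y)) * ((A i *v x) \<bullet> (A i *v x))"
    by (rule Cauchy_Schwarz_ineq)
  then show ?thesis using False
    by (simp add: field_simps power3_eq_cube power2_eq_square dot_square_norm)
qed simp

lemma C_nonneg: "0 \<le> x \<bullet> (C y *v x)"
  unfolding C_inner by (intro sum_nonneg C_quadratic_summand_nonneg)

text \<open>Equality in Cauchy--Schwarz for a single summand already makes \<open>A 1 *v x\<close> and \<open>A 1 *v y\<close>
  parallel, and \<open>A 1\<close> is injective.\<close>

lemma C_kernel:
  assumes "y \<noteq> 0" "x \<bullet> (C y *v x) = 0"
  shows "\<exists>c. x = c *\<^sub>R y"
proof -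
  have "((A 1 *v x) \<bullet> (A 1 *v x)) / norm (A 1 *v y)
    - ((A 1 *v y) \<bullet> (A 1 *v x)) * ((A 1 *v y) \<bullet> (A 1 *v x)) / norm (A 1 *v y) ^ 3 = 0"
    using assms(2) one_mem unfolding C_inner
    by (subst (asm) sum_nonneg_eq_0_iff) (use C_quadratic_summand_nonneg in auto)
  then have "((A 1 *v y) \<bullet> (A 1 *v x))\<^sup>2 = ((A 1 *v y) \<bullet> (A 1 *v y)) * ((A 1 *v x) \<bullet> (A 1 *v x))"
    using A_pos[OF one_mem assms(1)]
    by (simp add: field_simps power3_eq_cube power2_eq_square dot_square_norm)
  then have "\<bar>(A 1 *v y) \<bullet> (A 1 *v x)\<bar> = norm (A 1 *v y) * norm (A 1 *v x)"
    by (metis norm_eq_sqrt_inner power2_eq_iff_nonneg real_sqrt_abs real_sqrt_mult)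
  then have "collinear {0, A 1 *v y, A 1 *v x}"
    by (simp add: norm_cauchy_schwarz_equal)
  then obtain c where "A 1 *v x = c *\<^sub>R (A 1 *v y)"
    using A_pos[OF one_mem assms(1)] unfolding collinear_lemma
    by (metis norm_zero order_less_irrefl scale_zero_left)
  then have "A 1 *v (x - c *\<^sub>R y) = 0"
    by (simp add: matrix_vector_mult_diff_distrib matrix_vector_mult_scaleR)
  then show ?thesis
    using positive_definite_eq_0_iff[OF pd[OF one_mem]] by (metis right_minus_eq)
qed

text \<open>Differentiating \<open>grad (t *\<^sub>R y) = grad y\<close> in \<open>t\<close> predicts that \<open>y\<close> lies in the kernel of the
  Hessian.\<close>

lemma C_self: "C y *v y = 0"
  unfolding C_mult
proof (intro sum.neutral ballI)
  fix i
  show "(1 / norm (A i *v y)) *\<^sub>R (A i *v (A i *v y))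
    - ((A i *v y) \<bullet> (A i *v y) / norm (A i *v y) ^ 3) *\<^sub>R (A i *v (A i *v y)) = 0"
    by (cases "A i *v y = 0") (simp_all add: dot_square_norm power2_eq_square power3_eq_cube)
qed

lemma C_positive_semidefinite: "positive_semidefinite (C y)"
proof -
  have "x \<bullet> (transpose (C y) *v z) = x \<bullet> (C y *v z)" for x z
    by (metis C_inner_commute dot_lmul_matrix inner_commute transpose_matrix_vector)
  then have "transpose (C y) = C y"
    by (metis matrix_eq vector_eq_ldot)
  then show ?thesis by (simp add: positive_semidefinite_def C_nonneg)
qed

text \<open>The range of a symmetric matrix is the orthogonal complement of its kernel, here the line
  through \<open>y\<close>.\<close>

lemma C_rank:
  assumes "y \<noteq> 0"
  shows "rank (C y) = CARD('n) - 1"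
proof -
  have "{x \<in> UNIV. \<forall>w\<in>range ((*v) (C y)). orthogonal w x} = span {y}"
  proof (intro equalityI subsetI)
    fix x assume "x \<in> {x \<in> UNIV. \<forall>w\<in>range ((*v) (C y)). orthogonal w x}"
    then have "x \<bullet> (C y *v x) = 0" by (auto simp: orthogonal_def inner_commute)
    then show "x \<in> span {y}"
      using C_kernel[OF assms] by (auto simp: span_singleton)
  next
    fix x assume "x \<in> span {y}"
    then have "C y *v x = 0"
      by (auto simp: span_singleton matrix_vector_mult_scaleR C_self)
    then show "x \<in> {x \<in> UNIV. \<forall>w\<in>range ((*v) (C y)). orthogonal w x}"
      by (auto simp: orthogonal_def C_inner_commute[symmetric])
  qed
  moreover have "dim {x \<in> UNIV. \<forall>w\<in>range ((*v) (C y)). orthogonal w x} + dim (range ((*v) (C y)))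
    = dim (UNIV :: (real^'n) set)"
    by (intro dim_subspace_orthogonal_to_vectors linear_subspace_image) auto
  ultimately show ?thesis
    using assms by (simp add: rank_dim_range dim_singleton)
qed

section \<open>The boundary of the Minkowski sum\<close>

lemma mem_sum_iff: "z \<in> \<Sigma> \<longleftrightarrow> (\<exists>v. (\<forall>i\<in>{1..m}. norm (v i) < 1) \<and> z = (\<Sum>i\<in>{1..m}. A i *v v i))"
proof
  assume "z \<in> \<Sigma>"
  then obtain s where s: "\<forall>i\<in>{1..m}. s i \<in> solid_ellipsoid (A i)" "z = sum s {1..m}"
    unfolding ellipsoid_sum_def by (auto simp: set_sum_alt)
  then have "\<forall>i\<in>{1..m}. \<exists>v. norm v < 1 \<and> s i = A i *v v"
    by (auto simp: solid_ellipsoid_def)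
  then obtain v where "\<forall>i\<in>{1..m}. norm (v i) < 1 \<and> s i = A i *v v i" by metis
  then show "\<exists>v. (\<forall>i\<in>{1..m}. norm (v i) < 1) \<and> z = (\<Sum>i\<in>{1..m}. A i *v v i)"
    using s by (intro exI[of _ v]) auto
next
  assume "\<exists>v. (\<forall>i\<in>{1..m}. norm (v i) < 1) \<and> z = (\<Sum>i\<in>{1..m}. A i *v v i)"
  then show "z \<in> \<Sigma>"
    unfolding ellipsoid_sum_def by (auto simp: set_sum_alt solid_ellipsoid_def)
qed

text \<open>On each ellipsoid \<open>{A v | norm v < 1}\<close> the functional \<open>y\<close> is \<open>v \<mapsto> (A y) \<bullet> v\<close>, bounded by
  \<open>norm (A y)\<close>; the bound passes to the closure because half-spaces are closed.\<close>

lemma inner_le_support: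
  assumes "z \<in> closure \<Sigma>"
  shows "y \<bullet> z \<le> support y"
proof -
  have "\<Sigma> \<subseteq> {z. y \<bullet> z \<le> support y}"
  proof clarify
    fix z assume "z \<in> \<Sigma>"
    then obtain v where v: "\<forall>i\<in>{1..m}. norm (v i) < 1" "z = (\<Sum>i\<in>{1..m}. A i *v v i)"
      by (auto simp: mem_sum_iff)
    show "y \<bullet> z \<le> support y"
      unfolding v(2) inner_sum_right support_def
    proof (intro sum_mono)
      fix i assume i: "i \<in> {1..m}"
      have "y \<bullet> (A i *v v i) \<le> norm (A i *v y) * norm (v i)"
        using norm_cauchy_schwarz[of "A i *v y" "v i"] by (simp add: inner_A[OF i])
      also have "\<dots> \<le> norm (A i *v y)" using v(1) i by (simp add: less_imp_le mult_left_le)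
      finally show "y \<bullet> (A i *v v i) \<le> norm (A i *v y)" .
    qed
  qed
  then have "closure \<Sigma> \<subseteq> {z. y \<bullet> z \<le> support y}"
    by (intro closure_minimal closed_halfspace_le)
  then show ?thesis using assms by auto
qed

text \<open>The displacement \<open>- t *\<^sub>R y\<close> is split evenly over the summands. The \<open>i\<close>th point, pulled back to
  the unit ball, is \<open>u i = A i *v y / norm (A i *v y)\<close>, and the pulled-back share \<open>w i\<close> of \<open>y\<close> has
  positive inner product with it, because \<open>(A i *v y) \<bullet> (matrix_inv (A i) *v y) = y \<bullet> y\<close>.\<close>

lemma eventually_grad_minus_mem:
  assumes "y \<noteq> 0"
  shows "\<forall>\<^sub>F t in at_right 0. grad y - t *\<^sub>R y \<in> \<Sigma>"
proof -
  define u where "u i = (1 / norm (A i *v y)) *\<^sub>R (A i *v y)" for i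
  define w where "w i = (1 / real m) *\<^sub>R (matrix_inv (A i) *v y)" for i
  have Aw: "A i *v w i = (1 / real m) *\<^sub>R y" if "i \<in> {1..m}" for i
    using matrix_inv_right[OF positive_definite_invertible[OF pd[OF that]]]
    by (simp add: w_def matrix_vector_mult_scaleR matrix_vector_mul_assoc)
  have "\<forall>i\<in>{1..m}. \<forall>\<^sub>F t in at_right 0. norm (u i - t *\<^sub>R w i) < 1"
  proof
    fix i assume i: "i \<in> {1..m}"
    have "u i \<bullet> w i = (y \<bullet> y) / (real m * norm (A i *v y))"
      using i by (simp add: u_def inner_A Aw)
    then show "\<forall>\<^sub>F t in at_right 0. norm (u i - t *\<^sub>R w i) < 1"
      using A_pos[OF i assms] assms m by (intro norm_minus_scaleR_less) (auto simp: u_def)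
  qed
  then have "\<forall>\<^sub>F t in at_right 0. \<forall>i\<in>{1..m}. norm (u i - t *\<^sub>R w i) < 1"
    by (intro eventually_ball_finite) auto
  then show ?thesis
  proof (rule eventually_mono)
    fix t assume t: "\<forall>i\<in>{1..m}. norm (u i - t *\<^sub>R w i) < 1"
    have "(\<Sum>i\<in>{1..m}. A i *v (u i - t *\<^sub>R w i))
      = (\<Sum>i\<in>{1..m}. (1 / norm (A i *v y)) *\<^sub>R (A i *v (A i *v y)) - t *\<^sub>R (1 / real m) *\<^sub>R y)"
      using Aw by (intro sum.cong refl)
        (simp add: u_def matrix_vector_mult_diff_distrib matrix_vector_mult_scaleR)
    also have "\<dots> = grad y - (\<Sum>i\<in>{1..m}. t *\<^sub>R (1 / real m) *\<^sub>R y)"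
      by (simp add: grad_eq sum_subtractf)
    also have "(\<Sum>i\<in>{1..m}. t *\<^sub>R (1 / real m) *\<^sub>R y) = t *\<^sub>R y"
      using m by (subst sum_constant_scaleR) simp
    finally show "grad y - t *\<^sub>R y \<in> \<Sigma>"
      unfolding mem_sum_iff using t by (intro exI[of _ "\<lambda>i. u i - t *\<^sub>R w i"]) auto
  qed
qed

lemma grad_plus_notin_closure:
  assumes "y \<noteq> 0" "0 < t"
  shows "grad y + t *\<^sub>R y \<notin> closure \<Sigma>"
proof
  assume "grad y + t *\<^sub>R y \<in> closure \<Sigma>"
  from inner_le_support[OF this, of y] have "t * (y \<bullet> y) \<le> 0"
    by (simp add: inner_simps inner_grad)
  then show False using assms
    by (metis inner_gt_zero_iff mult_pos_pos not_le)
qed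

lemma grad_mem_closure: 
  assumes "y \<noteq> 0"
  shows "grad y \<in> closure \<Sigma>"
proof (rule Lim_in_closed_set[OF closed_closure])
  show "\<forall>\<^sub>F t in at_right 0. grad y - t *\<^sub>R y \<in> closure \<Sigma>"
    using eventually_grad_minus_mem[OF assms] by (rule eventually_mono) (use closure_subset in blast)
  show "((\<lambda>t. grad y - t *\<^sub>R y) \<longlongrightarrow> grad y) (at_right 0)"
    by (auto intro!: tendsto_eq_intros)
qed simp

lemma sum_open: "open \<Sigma>" and sum_convex: "convex \<Sigma>"
proof -
  have img: "solid_ellipsoid (A i) = (*v) (A i) ` ball 0 1" for i
    by (auto simp: solid_ellipsoid_def)
  show "convex \<Sigma>"
    unfolding ellipsoid_sum_def img
    by (intro convex_set_sum convex_linear_image convex_ball) auto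
  have "surj ((*v) (A 1))"
    using positive_definite_invertible[OF pd[OF one_mem]]
    by (metis invertible_right_inverse matrix_right_invertible_surjective)
  then have "open (solid_ellipsoid (A 1))"
    unfolding img by (intro open_surjective_linear_image) auto
  moreover have "\<Sigma> = solid_ellipsoid (A 1) + (\<Sum>i\<in>{1..m} - {1}. solid_ellipsoid (A i))"
    unfolding ellipsoid_sum_def using one_mem by (intro sum.remove) auto
  moreover have "S + T = (\<Union>x\<in>S. \<Union>y\<in>T. {x + y})" for S T :: "(real^'n) set"
    by (auto simp: set_plus_def)
  ultimately show "open \<Sigma>" by (simp add: open_sums)
qed

lemma grad_frontier:
  assumes "y \<noteq> 0"
  shows "grad y \<in> frontier \<Sigma>"
proof -
  have "grad y \<notin> \<Sigma>"
  proof
    assume "grad y \<in> \<Sigma>"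
    moreover have "((\<lambda>t. grad y + t *\<^sub>R y) \<longlongrightarrow> grad y) (at_right 0)"
      by (auto intro!: tendsto_eq_intros)
    ultimately have "\<forall>\<^sub>F t in at_right 0. grad y + t *\<^sub>R y \<in> \<Sigma>"
      using sum_open topological_tendstoD by blast
    then have "\<forall>\<^sub>F t in at_right (0::real). False"
      using eventually_at_right_less
      by eventually_elim (use grad_plus_notin_closure[OF assms] closure_subset in blast)
    then show False by simp
  qed
  then show ?thesis
    using grad_mem_closure[OF assms] sum_open by (simp add: frontier_def interior_open)
qed

text \<open>The inequality \<open>x \<bullet> z \<le> support x\<close> holds for all \<open>x\<close>, so where it is an equality the difference
  of both sides has a minimum, and its gradient \<open>grad y - z\<close> vanishes.\<close>

lemma eq_grad:
  assumes "z \<in> closure \<Sigma>" "y \<noteq> 0" "y \<bullet> z = support y"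
  shows "z = grad y"
proof -
  have "((\<lambda>x. support x - z \<bullet> x) has_derivative (\<lambda>x. grad y \<bullet> x - z \<bullet> x)) (at y)"
    by (intro has_derivative_diff support_has_derivative assms has_derivative_inner_right has_derivative_ident)
  then have "(\<lambda>x. grad y \<bullet> x - z \<bullet> x) = (\<lambda>x. 0)"
    using inner_le_support[OF assms(1)] assms(3)
    by (intro differential_zero_maxmin[of y UNIV "\<lambda>x. support x - z \<bullet> x"])
      (auto simp: inner_commute)
  then show ?thesis by (metis right_minus_eq vector_eq_rdot)
qed

text \<open>A supporting hyperplane at \<open>z\<close> gives a direction \<open>y\<close> in which \<open>z\<close> attains the support function.\<close>

lemma frontier_eq_grad:
  assumes "z \<in> frontier \<Sigma>"
  shows "\<exists>y\<in>sphere 0 1. z = grad y"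
proof -
  have z: "z \<in> closure \<Sigma>" "z \<notin> rel_interior \<Sigma>"
    using assms sum_open by (auto simp: frontier_def interior_open rel_interior_open)
  obtain a where a: "a \<noteq> 0" "\<And>w. w \<in> closure \<Sigma> \<Longrightarrow> a \<bullet> z \<le> a \<bullet> w"
    by (rule supporting_hyperplane_relative_frontier[OF sum_convex z]) blast
  define y where "y = - (1 / norm a) *\<^sub>R a"
  have y: "norm y = 1" "y \<noteq> 0" using a by (auto simp: y_def)
  have "y \<bullet> grad y \<le> y \<bullet> z"
    using a(2)[OF grad_mem_closure[OF y(2)]] a(1) by (simp add: y_def divide_right_mono)
  then have "y \<bullet> z = support y"
    using inner_le_support[OF z(1), of y] by (simp add: inner_grad)
  then show ?thesis using eq_grad[OF z(1) y(2)] y(1) by auto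
qed

end


section \<open>The Gauss map\<close>

context ellipsoids
begin

text \<open>If \<open>grad y = grad z\<close>, then this point also attains \<open>support z\<close>, which is possible only if each of
  its summands does; equality in Cauchy--Schwarz for the first summand then gives the claim.\<close>

lemma grad_eq_imp_parallel:
  assumes "y \<noteq> 0" "z \<noteq> 0" "grad y = grad z"
  shows "norm (A 1 *v z) *\<^sub>R y = norm (A 1 *v y) *\<^sub>R z"
proof -
  have le: "(A i *v z) \<bullet> (A i *v y) / norm (A i *v y) \<le> norm (A i *v z)" if "i \<in> {1..m}" for i
    using norm_cauchy_schwarz[of "A i *v z" "A i *v y"] A_pos[OF that assms(1)]
    by (simp add: divide_le_eq)
  have "z \<bullet> grad y = (\<Sum>i\<in>{1..m}. (A i *v z) \<bullet> (A i *v y) / norm (A i *v y))"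
    unfolding grad_eq inner_sum_right by (intro sum.cong refl) (simp add: inner_A)
  moreover have "z \<bullet> grad y = support z"
    using assms(3) by (simp add: inner_grad)
  ultimately have "(\<Sum>i\<in>{1..m}. norm (A i *v z) - (A i *v z) \<bullet> (A i *v y) / norm (A i *v y)) = 0"
    by (simp add: support_def sum_subtractf)
  then have "norm (A 1 *v z) - (A 1 *v z) \<bullet> (A 1 *v y) / norm (A 1 *v y) = 0"
    using one_mem le by (subst (asm) sum_nonneg_eq_0_iff) auto
  then have "(A 1 *v z) \<bullet> (A 1 *v y) = norm (A 1 *v z) * norm (A 1 *v y)"
    using A_pos[OF one_mem assms(1)] by (simp add: field_simps)
  then have "norm (A 1 *v z) *\<^sub>R (A 1 *v y) = norm (A 1 *v y) *\<^sub>R (A 1 *v z)"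
    by (simp add: norm_cauchy_schwarz_eq)
  then have "A 1 *v (norm (A 1 *v z) *\<^sub>R y - norm (A 1 *v y) *\<^sub>R z) = 0"
    by (simp add: matrix_vector_mult_diff_distrib matrix_vector_mult_scaleR)
  then show ?thesis
    using positive_definite_eq_0_iff[OF pd[OF one_mem]] by (metis right_minus_eq)
qed

lemma grad_inj:
  assumes "grad y = grad z" "norm y = norm z" "y \<noteq> 0"
  shows "y = z"
proof -
  have z: "z \<noteq> 0" using assms by auto
  have eq: "norm (A 1 *v z) *\<^sub>R y = norm (A 1 *v y) *\<^sub>R z"
    using grad_eq_imp_parallel[OF assms(3) z assms(1)] .
  then have "norm (norm (A 1 *v z) *\<^sub>R y) = norm (norm (A 1 *v y) *\<^sub>R z)" by simp
  then have "norm (A 1 *v z) = norm (A 1 *v y)" using assms z by simp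
  then show ?thesis using eq A_pos[OF one_mem z] by auto
qed

lemma grad_scaleR: 
  assumes "0 < c"
  shows "grad (c *\<^sub>R y) = grad y"
  unfolding grad_eq using assms
  by (intro sum.cong refl) (simp add: matrix_vector_mult_scaleR)

text \<open>On the sphere \<open>grad\<close> is injective, but its values do not fill a neighbourhood. The map
  \<open>F y = norm y *\<^sub>R grad y\<close> extends it to an injective map between open sets of the same dimension,
  whose derivative at a unit vector \<open>n\<close> adds the missing direction \<open>grad n\<close> to the range of \<open>C n\<close>
  and is invertible. The inverse function theorem, in the form that needs differentiability at one
  point only, makes the inverse of \<open>F\<close> differentiable at \<open>F n = grad n\<close>.\<close>

lemma gauss_map_exists:
  "\<exists>\<nu>. \<forall>y\<in>sphere 0 1. \<nu> (grad y) = y \<and> \<nu> differentiable at (grad y)"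
proof -
  define F where "F y = norm y *\<^sub>R grad y" for y
  have le: "norm z \<le> norm y" if "F y = F z" "z \<noteq> 0" for y z
  proof -
    \<comment> \<open>\<open>F z\<close> attains \<open>norm z * support z\<close> in the direction \<open>z\<close>, whereas \<open>F y\<close> reaches at most
      \<open>norm y * support z\<close>.\<close>
    have "norm z * support z = z \<bullet> F y"
      using that by (simp add: F_def inner_grad)
    also have "\<dots> \<le> norm y * support z"
      by (simp add: F_def mult_left_mono inner_grad_le)
    finally show ?thesis using support_pos[OF that(2)] by simp
  qed
  have inj: "inj_on F (- {0})"
  proof (rule inj_onI)
    fix y z assume *: "y \<in> - {0}" "z \<in> - {0}" "F y = F z"
    then have "norm y = norm z" using le[of y z] le[of z y] by simp
    then show "y = z" using * grad_inj[of y z] by (auto simp: F_def)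
  qed
  define \<nu> where "\<nu> = inv_into (- {0}) F"
  have \<nu>: "\<nu> (F y) = y" if "y \<noteq> 0" for y
    unfolding \<nu>_def by (intro inv_into_f_f inj) (use that in auto)
  have cont: "continuous_on (- {0}) F"
  proof (rule continuous_at_imp_continuous_on, rule ballI)
    fix y :: "real^'n" assume "y \<in> - {0}"
    then have "isCont grad y"
      using has_derivative_continuous[OF grad_has_derivative] by auto
    then show "isCont F y" unfolding F_def by (intro continuous_intros)
  qed
  have "\<nu> differentiable at (grad n)" if n: "norm n = 1" for n
  proof -
    have n0: "n \<noteq> 0" using n by auto
    let ?F' = "\<lambda>x. C n *v x + (n \<bullet> x) *\<^sub>R grad n"
    have F': "(F has_derivative ?F') (at n)"
      unfolding F_def
      by (rule has_derivative_eq_rhs[OF has_derivative_scaleR[OF has_derivative_norm[OF n0] grad_has_derivative[OF n0]]])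
        (use n in \<open>simp add: sgn_div_norm inner_commute fun_eq_iff\<close>)
    then have lin: "linear ?F'" by (rule has_derivative_linear)
    have "x = 0" if "?F' x = 0" for x
    proof -
      have "n \<bullet> ?F' x = (n \<bullet> x) * support n"
        by (simp add: inner_add_right inner_grad C_inner_commute C_self)
      then have nx: "n \<bullet> x = 0" using that support_pos[OF n0] by simp
      then have "C n *v x = 0" using that by simp
      then obtain c where "x = c *\<^sub>R n" using C_kernel[OF n0, of x] by auto
      then show ?thesis using nx n0 by simp
    qed
    then have "inj ?F'" by (subst linear_injective_0[OF lin]) blast
    then have "surj ?F'" using linear_injective_imp_surjective[OF lin] by simp
    then obtain g' where "?F' \<circ> g' = id"
      using linear_surjective_right_inverse[OF lin] by blast
    then have "(\<nu> has_derivative g') (at (F n))"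
      using n0 \<nu> cont F' by (intro has_derivative_inverse_strong[of "- {0}" n F \<nu> ?F' g']) auto
    then show ?thesis using n by (auto simp: F_def differentiable_def)
  qed
  moreover have "\<nu> (grad n) = n" if "norm n = 1" for n
    using \<nu>[of n] that by (force simp: F_def)
  ultimately show ?thesis by (intro exI[of _ \<nu>]) auto
qed

text \<open>Values away from the frontier are constrained only by differentiability at frontier points, as a
  map on the ambient space. This lets the Gauss map be composed with arbitrary coordinates.\<close>

definition gauss_map :: "real^'n \<Rightarrow> real^'n" where
  "gauss_map = (SOME \<nu>. \<forall>y\<in>sphere 0 1. \<nu> (grad y) = y \<and> \<nu> differentiable at (grad y))"

lemma gauss_map_grad: "norm y = 1 \<Longrightarrow> gauss_map (grad y) = y"
  and gauss_map_differentiable: "norm y = 1 \<Longrightarrow> gauss_map differentiable at (grad y)"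
  using someI_ex[OF gauss_map_exists] unfolding gauss_map_def by auto

lemma gauss_map_frontier:
  assumes "z \<in> frontier \<Sigma>"
  shows "norm (gauss_map z) = 1" "grad (gauss_map z) = z" "gauss_map differentiable at z"
  using frontier_eq_grad[OF assms] by (auto simp: gauss_map_grad gauss_map_differentiable)

lemma continuous_on_gauss_map: "continuous_on (frontier \<Sigma>) gauss_map"
  using gauss_map_frontier(3) differentiable_imp_continuous_within
  by (intro continuous_at_imp_continuous_on) blast

end

section \<open>An eigenframe of the tangent space\<close>

text \<open>An orthonormal basis \<open>b\<close> of the tangent space with normal \<open>n\<close>, consisting of eigenvectors of
  \<open>C n\<close>. In this basis both the coordinates and the shape operator become explicit.\<close>

locale normal_frame = ellipsoids A m for A :: "nat \<Rightarrow> real^'n^'n" and m +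
  fixes n :: "real^'n" and b :: "'k::finite \<Rightarrow> real^'n" and ev :: "'k \<Rightarrow> real"
  assumes n: "norm n = 1"
    and b_normal: "\<And>l. n \<bullet> b l = 0"
    and b_orthonormal: "\<And>k l. b k \<bullet> b l = (if k = l then 1 else 0)"
    and b_expand: "\<And>v. n \<bullet> v = 0 \<Longrightarrow> (\<Sum>l\<in>UNIV. (b l \<bullet> v) *\<^sub>R b l) = v"
    and eigen: "\<And>l. C n *v b l = ev l *\<^sub>R b l"
    and pos: "\<And>l. 0 < ev l"
    and spectrum: "eigenvalues (C n) = {#0#} + image_mset ev (mset_set UNIV)"

text \<open>The spectral theorem is applied on the orthogonal complement of \<open>n\<close>; adjoining \<open>n\<close> itself, with
  eigenvalue \<open>0\<close>, gives an eigenbasis of the whole space and hence all eigenvalues of \<open>C n\<close>.\<close>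

lemma (in ellipsoids) normal_frame_exists:
  fixes n :: "real^'n"
  assumes n: "norm n = 1" and card: "CARD('n) = CARD('k::finite) + 1"
  shows "\<exists>b (ev :: 'k \<Rightarrow> real). normal_frame A m n b ev"
proof -
  have n0: "n \<noteq> 0" using n by auto
  define S where "S = {x. n \<bullet> x = 0}"
  have "subspace S" unfolding S_def by (rule subspace_hyperplane)
  moreover have "(*v) (C n) ` S \<subseteq> S"
    by (auto simp: S_def C_inner_commute C_self)
  ultimately obtain B where B: "B \<subseteq> S" "pairwise orthogonal B"
    and eig: "\<And>b. b \<in> B \<Longrightarrow> norm b = 1 \<and> (\<exists>\<mu>. C n *v b = \<mu> *\<^sub>R b)"
    and sp: "span B = S" and "card B = dim S"
    using self_adjoint_orthonormal_eigenbasis[OF matrix_vector_mul_linear C_inner_commute, of S n]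
    by metis
  then have cB: "card B = CARD('k)"
    using card dim_hyperplane[OF n0] by (simp add: S_def)
  then have fB: "finite B" by (metis card_gt_0_iff zero_less_card_finite)
  obtain b :: "'k \<Rightarrow> real^'n" where b: "bij_betw b UNIV B"
    using cB fB by (metis finite_same_card_bij finite)
  have bB: "b l \<in> B" for l using b bij_betwE by blast
  define ev where "ev l = b l \<bullet> (C n *v b l)" for l
  define \<mu> where "\<mu> v = v \<bullet> (C n *v v)" for v
  have eig': "C n *v v = \<mu> v *\<^sub>R v" if v: "v \<in> insert n B" for v
  proof (cases "v = n")
    case False
    then obtain c where "C n *v v = c *\<^sub>R v" "v \<bullet> v = 1"
      using eig v by (auto simp: norm_eq_1)
    then show ?thesis by (simp add: \<mu>_def)
  qed (simp add: \<mu>_def C_self)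
  have nB: "n \<notin> B" using B n by (auto simp: S_def norm_eq_1)
  have spec: "eigenvalues (C n) = image_mset \<mu> (mset_set (insert n B))"
  proof (rule eigenvalues_orthonormal_eigenbasis[OF _ _ _ eig'])
    show "pairwise orthogonal (insert n B)"
      using B by (auto simp: pairwise_insert S_def orthogonal_def inner_commute)
    show "norm v = 1" if "v \<in> insert n B" for v using that n eig by auto
    show "card (insert n B) = CARD('n)" using nB fB cB card by simp
  qed
  have img: "mset_set B = image_mset b (mset_set UNIV)"
    using b by (metis bij_betw_def image_mset_mset_set)
  have "normal_frame A m n b ev"
  proof unfold_locales
    show "norm n = 1" by fact
    show nb: "n \<bullet> b l = 0" for l using bB B by (auto simp: S_def)
    show on: "b k \<bullet> b l = (if k = l then 1 else 0)" for k l
    proof (cases "k = l")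
      case True
      then show ?thesis using eig[OF bB] by (simp add: norm_eq_1)
    next
      case False
      then have "b k \<noteq> b l" using b by (auto simp: bij_betw_def inj_on_def)
      then show ?thesis using B(2) bB False by (auto simp: pairwise_def orthogonal_def)
    qed
    show "(\<Sum>l\<in>UNIV. (b l \<bullet> v) *\<^sub>R b l) = v" if "n \<bullet> v = 0" for v
    proof -
      have "(\<Sum>w\<in>B. (v \<bullet> w) *\<^sub>R w) = v"
        using B eig sp fB that by (intro orthonormal_basis_expand) (auto simp: S_def)
      then show ?thesis
        using sum.reindex_bij_betw[OF b, of "\<lambda>w. (v \<bullet> w) *\<^sub>R w"] by (simp add: inner_commute)
    qed
    show "C n *v b l = ev l *\<^sub>R b l" for l
      using eig'[of "b l"] bB by (simp add: \<mu>_def ev_def)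
    show "0 < ev l" for l
    proof -
      have "ev l \<noteq> 0"
      proof
        assume "ev l = 0"
        then obtain c where "b l = c *\<^sub>R n" using C_kernel[OF n0, of "b l"] by (auto simp: ev_def)
        then show False using nb[of l] on[of l l] n0 by auto
      qed
      then show ?thesis using C_nonneg[of "b l" n] by (simp add: ev_def)
    qed
    have "\<mu> n = 0" by (simp add: \<mu>_def C_self)
    then show "eigenvalues (C n) = {#0#} + image_mset ev (mset_set UNIV)"
      unfolding spec using nB fB
      by (simp add: img multiset.map_comp comp_def) (simp add: \<mu>_def ev_def[abs_def])
  qed
  then show ?thesis by blast
qed


section \<open>Local coordinates of the boundary\<close>

lemma has_derivative_eq_frechet:
  "(f has_derivative f') (at x) \<Longrightarrow> frechet_derivative f (at x) = f'"
  by (rule frechet_derivative_at[symmetric])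

lemma has_derivative_coordinate_sum:
  fixes b :: "'k::finite \<Rightarrow> 'a::real_normed_vector"
  shows "((\<lambda>w::real^'k. \<Sum>l\<in>UNIV. w $ l *\<^sub>R b l) has_derivative (\<lambda>w. \<Sum>l\<in>UNIV. w $ l *\<^sub>R b l)) F"
  by (intro has_derivative_sum has_derivative_scaleR_left bounded_linear_imp_has_derivative
      bounded_linear_vec_nth)

context normal_frame
begin

lemma n_nonzero: "n \<noteq> 0"
  using n by auto

text \<open>Central projection identifies the affine tangent hyperplane \<open>n + span (range b)\<close> with the open
  hemisphere around \<open>n\<close>. Since \<open>grad\<close> is homogeneous of degree zero, \<open>grad (lift w)\<close> is the boundary
  point whose normal is the projection of \<open>lift w\<close>.\<close>

definition lift :: "real^'k \<Rightarrow> real^'n" where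
  "lift w = n + (\<Sum>l\<in>UNIV. w $ l *\<^sub>R b l)"

lemma inner_b_sum: "b k \<bullet> (\<Sum>l\<in>UNIV. w $ l *\<^sub>R b l) = w $ k"
  by (simp add: inner_sum_right b_orthonormal if_distrib cong: if_cong)

lemma n_lift: "n \<bullet> lift w = 1"
  using n by (simp add: lift_def inner_add_right inner_sum_right b_normal norm_eq_1)

lemma b_lift: "b k \<bullet> lift w = w $ k"
  by (simp add: lift_def inner_add_right inner_b_sum inner_commute[of _ n] b_normal)

lemma lift_nonzero: "lift w \<noteq> 0"
  using n_lift[of w] by auto

lemma lift_has_derivative: "(lift has_derivative (\<lambda>w. \<Sum>l\<in>UNIV. w $ l *\<^sub>R b l)) (at u)"
  unfolding lift_def
  by (rule has_derivative_eq_rhs[OF has_derivative_add[OF has_derivative_const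
        has_derivative_coordinate_sum]]) simp

lemma sum_axis: "(\<Sum>l\<in>UNIV. axis i 1 $ l *\<^sub>R b l) = b i"
proof -
  have "(\<Sum>l\<in>UNIV. axis i 1 $ l *\<^sub>R b l) = (\<Sum>l\<in>UNIV. if l = i then b l else 0)"
    by (intro sum.cong refl) (simp add: axis_def)
  then show ?thesis by simp
qed

definition chart :: "real^'k \<Rightarrow> real^'n" where
  "chart w = grad (lift w)"

lemma chart_has_derivative:
  "(chart has_derivative (\<lambda>v. C (lift w) *v (\<Sum>l\<in>UNIV. v $ l *\<^sub>R b l))) (at w)"
  unfolding chart_def
  by (rule has_derivative_compose[OF lift_has_derivative grad_has_derivative[OF lift_nonzero]])

lemma partial_chart: "partial i chart = (\<lambda>w. C (lift w) *v b i)"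
  by (simp add: partial_def has_derivative_eq_frechet[OF chart_has_derivative] sum_axis fun_eq_iff)

lemma partial_chart_has_derivative:
  "(partial i chart has_derivative (\<lambda>v. C_derivative (lift w) (b i) (\<Sum>l\<in>UNIV. v $ l *\<^sub>R b l))) (at w)"
  unfolding partial_chart
  by (rule has_derivative_compose[OF lift_has_derivative C_mult_has_derivative[OF lift_nonzero]])

lemma partial_partial_chart: "partial i (partial j chart) = (\<lambda>w. C_derivative (lift w) (b j) (b i))"
  unfolding partial_def[of i]
  by (simp add: has_derivative_eq_frechet[OF partial_chart_has_derivative] sum_axis fun_eq_iff)

lemma continuous_on_lift: "continuous_on U lift"
  unfolding lift_def by (intro continuous_intros)

lemma C2_on_chart: "C2_on UNIV chart"
  unfolding C2_on_def
proof (intro conjI allI)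
  show "chart differentiable_on UNIV"
    using chart_has_derivative by (auto simp: differentiable_on_def differentiable_def)
  show "partial i chart differentiable_on UNIV" for i
    using partial_chart_has_derivative by (auto simp: differentiable_on_def differentiable_def)
  show "continuous_on UNIV (partial i (partial j chart))" for i j
    unfolding partial_partial_chart
    by (intro continuous_on_C_derivative continuous_on_lift lift_nonzero)
qed

text \<open>The kernel of \<open>C (lift w)\<close> is the line through \<open>lift w\<close>, which is transversal to the tangent space
  at \<open>grad n\<close>.\<close>

lemma inj_chart_derivative: "inj (frechet_derivative chart (at w))"
proof -
  have "v = 0" if "C (lift w) *v (\<Sum>l\<in>UNIV. v $ l *\<^sub>R b l) = 0" for v
  proof -
    obtain c where c: "(\<Sum>l\<in>UNIV. v $ l *\<^sub>R b l) = c *\<^sub>R lift w"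
      using C_kernel[OF lift_nonzero, of "\<Sum>l\<in>UNIV. v $ l *\<^sub>R b l" w] \<open>_ = 0\<close> by auto
    have "n \<bullet> (\<Sum>l\<in>UNIV. v $ l *\<^sub>R b l) = 0"
      by (simp add: inner_sum_right b_normal)
    then have "c = 0" using c n_lift[of w] by simp
    then have "v $ k = 0" for k using c inner_b_sum[of k v] by simp
    then show ?thesis by (simp add: vec_eq_iff)
  qed
  then show ?thesis
    unfolding has_derivative_eq_frechet[OF chart_has_derivative]
    by (subst linear_injective_0[OF has_derivative_linear[OF chart_has_derivative]]) blast
qed

lemma gauss_map_chart: "gauss_map (chart w) = (1 / norm (lift w)) *\<^sub>R lift w"
proof -
  have "chart w = grad ((1 / norm (lift w)) *\<^sub>R lift w)"
    using lift_nonzero by (simp add: chart_def grad_scaleR)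
  then show ?thesis using lift_nonzero by (simp add: gauss_map_grad)
qed

text \<open>The chart covers the points whose normal lies in the open hemisphere around \<open>n\<close>, so continuity
  of the Gauss map makes its range relatively open.\<close>

lemma range_chart: "range chart = frontier \<Sigma> \<inter> gauss_map -` {v. 0 < n \<bullet> v}"
proof (intro equalityI subsetI)
  fix z assume "z \<in> range chart"
  then obtain w where "z = chart w" by blast
  then show "z \<in> frontier \<Sigma> \<inter> gauss_map -` {v. 0 < n \<bullet> v}"
    using lift_nonzero grad_frontier by (auto simp: gauss_map_chart n_lift) (simp add: chart_def)
next
  fix z assume z: "z \<in> frontier \<Sigma> \<inter> gauss_map -` {v. 0 < n \<bullet> v}"
  define v where "v = gauss_map z"
  have v: "grad v = z" "0 < n \<bullet> v" using z gauss_map_frontier by (auto simp: v_def)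
  let ?y = "(1 / (n \<bullet> v)) *\<^sub>R v"
  let ?w = "\<chi> l. b l \<bullet> ?y"
  have "n \<bullet> (?y - n) = 0" using v n by (simp add: inner_diff_right norm_eq_1)
  from b_expand[OF this] have "lift ?w = ?y"
    by (simp add: lift_def inner_diff_right inner_commute[of _ n] b_normal)
  then have "chart ?w = z" using v by (simp add: chart_def grad_scaleR)
  then show "z \<in> range chart" by blast
qed

lemma local_coordinates_chart: "local_coordinates (frontier \<Sigma>) (grad n) UNIV chart 0"
  unfolding local_coordinates_def
proof (intro conjI ballI)
  show "chart 0 = grad n" by (simp add: chart_def lift_def)
  show "openin (top_of_set (frontier \<Sigma>)) (range chart)"
    unfolding range_chart
    by (intro continuous_openin_preimage_gen continuous_on_gauss_map open_halfspace_gt)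
  define g where "g z = (\<chi> l. (b l \<bullet> gauss_map z) / (n \<bullet> gauss_map z))" for z
  have "homeomorphism UNIV (range chart) chart g"
    unfolding homeomorphism_def
  proof (intro conjI ballI)
    show "g (chart w) = w" for w
      using lift_nonzero[of w] by (simp add: g_def gauss_map_chart b_lift n_lift)
    then show "chart (g z) = z" if "z \<in> range chart" for z using that by auto
    show "g ` range chart = UNIV" using \<open>\<And>w. g (chart w) = w\<close> by (metis image_image image_ident surj_def rangeI)
    show "continuous_on UNIV chart"
      using chart_has_derivative has_derivative_continuous
      by (intro continuous_at_imp_continuous_on) blast
    have "continuous_on (range chart) gauss_map"
      by (rule continuous_on_subset[OF continuous_on_gauss_map]) (auto simp: range_chart)
    then show "continuous_on (range chart) g"
      unfolding g_def by (intro continuous_on_vec_lambda continuous_intros) (auto simp: range_chart)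
  qed simp
  then show "\<exists>g. homeomorphism UNIV (range chart) chart g" by blast
qed (use C2_on_chart inj_chart_derivative in auto)

section \<open>Principal curvatures\<close>

text \<open>Let \<open>\<nu>\<close> be the Gauss map in the coordinates \<open>x\<close>, so that \<open>x w = grad (\<nu> w)\<close>. Differentiation gives
  \<open>x' v = C n *v \<nu>' v\<close>. Since \<open>x w\<close> attains \<open>support (\<nu> w)\<close>, it maximises the functional \<open>\<nu> w\<close> on the
  surface, so \<open>\<nu> w \<bullet> partial j x w = 0\<close>; differentiating this once more expresses the second
  fundamental form through \<open>\<nu>'\<close> and \<open>x'\<close>. In the eigenframe \<open>b\<close> both forms are then products of the
  coordinate matrix \<open>R\<close> of \<open>\<nu>'\<close> with diagonal matrices.\<close>

lemma curvature_in_coordinates: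
  fixes x :: "real^'k \<Rightarrow> real^'n"
  assumes coords: "local_coordinates (frontier \<Sigma>) (grad n) U x u"
  shows "outward_unit_normal \<Sigma> x u n"
    and "eigenvalues (matrix_inv (metric_tensor x u) ** second_fundamental_form n x u)
      = image_mset (\<lambda>l. inverse (ev l)) (mset_set UNIV)"
proof -
  have U: "open U" "u \<in> U" and xu: "x u = grad n"
    using coords by (auto simp: local_coordinates_def)
  define x' where "x' w = frechet_derivative x (at w)" for w
  have diff: "(x has_derivative x' w) (at w)" if "w \<in> U" for w
    unfolding x'_def using coords that U frechet_derivative_works
    by (auto simp: local_coordinates_def C2_on_def differentiable_on_eq_differentiable_at)
  have part: "partial i x w = x' w (axis i 1)" for i w by (simp add: partial_def x'_def)
  have inj: "inj (x' u)" using coords U by (simp add: local_coordinates_def x'_def)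
  define \<nu> where "\<nu> w = gauss_map (x w)" for w
  have fr: "x w \<in> frontier \<Sigma>" if "w \<in> U" for w
    using coords that openin_imp_subset by (fastforce simp: local_coordinates_def)
  have \<nu>: "norm (\<nu> w) = 1" "grad (\<nu> w) = x w" if "w \<in> U" for w
    using gauss_map_frontier[OF fr[OF that]] by (auto simp: \<nu>_def)
  have \<nu>u: "\<nu> u = n" using n by (simp add: \<nu>_def xu gauss_map_grad)
  obtain g' where "(gauss_map has_derivative g') (at (x u))"
    using gauss_map_frontier(3)[OF fr[OF U(2)]] by (auto simp: differentiable_def)
  then have "(\<nu> has_derivative (\<lambda>v. g' (x' u v))) (at u)"
    unfolding \<nu>_def by (rule has_derivative_compose[OF diff[OF U(2)]])
  then obtain \<nu>' where \<nu>': "(\<nu> has_derivative \<nu>') (at u)" by blast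
  have normal: "\<nu> w \<bullet> x' w v = 0" if w: "w \<in> U" for w v
  proof -
    have "((\<lambda>v. \<nu> w \<bullet> x v) has_derivative (\<lambda>v. \<nu> w \<bullet> x' w v)) (at w)"
      by (intro has_derivative_inner_right diff w)
    moreover have "\<nu> w \<bullet> x v \<le> \<nu> w \<bullet> x w" if "v \<in> U" for v
      using inner_grad_le[of "\<nu> w" "\<nu> v"] inner_grad[of "\<nu> w"] \<nu>[OF w] \<nu>[OF that] by simp
    ultimately have "(\<lambda>v. \<nu> w \<bullet> x' w v) = (\<lambda>v. 0)"
      by (intro differential_zero_maxmin[OF w U(1)]) auto
    then show ?thesis by metis
  qed
  \<comment> \<open>Here and below the derivative of a function that is constant on \<open>U\<close> vanishes because every
    point of \<open>U\<close> is an extremum.\<close>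
  have \<nu>'_tangent: "n \<bullet> \<nu>' v = 0" for v
  proof -
    have "((\<lambda>w. \<nu> w \<bullet> \<nu> w) has_derivative (\<lambda>v. \<nu> u \<bullet> \<nu>' v + \<nu>' v \<bullet> \<nu> u)) (at u)"
      by (intro has_derivative_inner \<nu>')
    moreover have "\<nu> w \<bullet> \<nu> w = 1" if "w \<in> U" for w using \<nu>[OF that] by (simp add: norm_eq_1)
    ultimately have "(\<lambda>v. \<nu> u \<bullet> \<nu>' v + \<nu>' v \<bullet> \<nu> u) = (\<lambda>v. 0)"
      using U by (intro differential_zero_maxmin[OF U(2,1)]) auto
    then have "\<nu> u \<bullet> \<nu>' v + \<nu>' v \<bullet> \<nu> u = 0" by meson
    then show ?thesis by (simp add: \<nu>u inner_commute)
  qed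
  have x'_eq: "x' u v = C n *v \<nu>' v" for v
  proof -
    have "((\<lambda>w. grad (\<nu> w)) has_derivative (\<lambda>v. C n *v \<nu>' v)) (at u)"
      using grad_has_derivative[OF n_nonzero] by (intro has_derivative_compose[OF \<nu>']) (simp add: \<nu>u)
    then have "(x has_derivative (\<lambda>v. C n *v \<nu>' v)) (at u)"
      by (rule has_derivative_transform_within_open[OF _ U]) (simp add: \<nu>)
    then show ?thesis using has_derivative_unique[OF diff[OF U(2)]] by metis
  qed
  have second: "n \<bullet> partial i (partial j x) u = - (\<nu>' (axis i 1) \<bullet> x' u (axis j 1))" for i j
  proof -
    have "partial j x differentiable (at u)"
      using coords U by (auto simp: local_coordinates_def C2_on_def differentiable_on_eq_differentiable_at)
    then have "(partial j x has_derivative frechet_derivative (partial j x) (at u)) (at u)"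
      by (simp add: frechet_derivative_works)
    then have "((\<lambda>w. \<nu> w \<bullet> partial j x w) has_derivative
      (\<lambda>v. \<nu> u \<bullet> frechet_derivative (partial j x) (at u) v + \<nu>' v \<bullet> partial j x u)) (at u)"
      by (intro has_derivative_inner \<nu>')
    moreover have "\<nu> w \<bullet> partial j x w = 0" if "w \<in> U" for w
      using normal[OF that] by (simp add: part)
    ultimately have "(\<lambda>v. \<nu> u \<bullet> frechet_derivative (partial j x) (at u) v + \<nu>' v \<bullet> partial j x u) = (\<lambda>v. 0)"
      using U by (intro differential_zero_maxmin[OF U(2,1)]) auto
    then have "\<nu> u \<bullet> frechet_derivative (partial j x) (at u) (axis i 1) + \<nu>' (axis i 1) \<bullet> partial j x u = 0"
      by meson
    then show ?thesis unfolding \<nu>u part by (simp add: partial_def)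
  qed
  show "outward_unit_normal \<Sigma> x u n"
    unfolding outward_unit_normal_def
  proof (intro conjI allI)
    show "norm n = 1" by (rule n)
    show "n \<bullet> partial i x u = 0" for i using normal[OF U(2)] by (simp add: part \<nu>u)
    show "\<forall>\<^sub>F t in at_right 0. x u + t *\<^sub>R n \<notin> closure \<Sigma> \<and> x u - t *\<^sub>R n \<in> \<Sigma>"
      using eventually_at_right_less[of 0] eventually_grad_minus_mem[OF n_nonzero]
      by eventually_elim (simp add: xu grad_plus_notin_closure[OF n_nonzero])
  qed
  define R where "R = (\<chi> l j. b l \<bullet> \<nu>' (axis j 1))"
  have lin: "linear \<nu>'" using \<nu>' by (rule has_derivative_linear)
  have Rv: "(R *v v) $ l = b l \<bullet> \<nu>' v" for v l
  proof -
    have "\<nu>' v = (\<Sum>j\<in>UNIV. v $ j *\<^sub>R \<nu>' (axis j 1))"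
      using linear_sum[OF lin, of "\<lambda>j. v $ j *\<^sub>R axis j 1" UNIV] linear_cmul[OF lin]
        basis_expansion[of v] by (simp add: scalar_mult_eq_scaleR)
    then show ?thesis
      by (simp add: R_def matrix_vector_mult_def inner_sum_right mult.commute)
  qed
  have "v = 0" if "R *v v = 0" for v
  proof -
    have "b l \<bullet> \<nu>' v = 0" for l using Rv[of v l] that by simp
    then have "\<nu>' v = 0" using b_expand[OF \<nu>'_tangent[of v]] by simp
    then have "x' u v = 0" by (simp add: x'_eq)
    then show ?thesis
      using inj linear_injective_0[OF has_derivative_linear[OF diff[OF U(2)]]] by blast
  qed
  then have R: "invertible R"
    by (simp add: invertible_left_inverse matrix_left_invertible_ker)
  have bx: "b l \<bullet> x' u (axis j 1) = ev l * R $ l $ j" for l j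
    by (simp add: x'_eq C_inner_commute eigen R_def)
  have parseval: "v \<bullet> w = (\<Sum>l\<in>UNIV. (b l \<bullet> v) * (b l \<bullet> w))" if "n \<bullet> v = 0" for v w
    using arg_cong[OF b_expand[OF that], of "\<lambda>v. v \<bullet> w"] by (simp add: inner_sum_left)
  have entry: "(transpose R ** diagonal_matrix d ** R) $ i $ j = (\<Sum>l\<in>UNIV. d l * R $ l $ i * R $ l $ j)"
    for d i j
    by (simp add: matrix_matrix_mult_def[of "_ ** _"] mult_diagonal_matrix_nth)
      (simp add: transpose_def mult_ac)
  have "metric_tensor x u = transpose R ** diagonal_matrix (\<lambda>l. ev l * ev l) ** R"
    unfolding vec_eq_iff entry
    using normal[OF U(2)] by (simp add: metric_tensor_def part parseval \<nu>u bx mult_ac)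
  moreover have "second_fundamental_form n x u = transpose R ** diagonal_matrix ev ** R"
    unfolding vec_eq_iff entry
    by (simp add: second_fundamental_form_def second parseval \<nu>'_tangent bx)
      (simp add: R_def mult_ac)
  ultimately show "eigenvalues (matrix_inv (metric_tensor x u) ** second_fundamental_form n x u)
      = image_mset (\<lambda>l. inverse (ev l)) (mset_set UNIV)"
    using pos by (intro eigenvalues_shape_operator[OF R]) (auto simp: less_imp_neq[symmetric])
qed

lemma principal_curvatures:
  "has_principal_curvatures TYPE('k) \<Sigma> (grad n) n
     (image_mset inverse (filter_mset (\<lambda>c. 0 < c) (eigenvalues (C n))))"
proof -
  have "image_mset inverse (filter_mset (\<lambda>c. 0 < c) (eigenvalues (C n)))
    = image_mset (\<lambda>l. inverse (ev l)) (mset_set UNIV)"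
    by (simp add: spectrum filter_mset_image_mset pos multiset.map_comp comp_def)
  then show ?thesis
    unfolding has_principal_curvatures_def
    using local_coordinates_chart curvature_in_coordinates by metis
qed

end


theorem theorem1p2:
  fixes A :: "nat \<Rightarrow> real^'n^'n" and m :: nat
  assumes "1 \<le> m"
    and "\<And>i. i \<in> {1..m} \<Longrightarrow> positive_definite (A i)"
  shows "\<forall>n\<in>sphere 0 1.
    positive_semidefinite (curvature_matrix A m n) \<and>
    rank (curvature_matrix A m n) = CARD('n) - 1 \<and>
    boundary_point A m n \<in> frontier (ellipsoid_sum A m) \<and>
    (CARD('n) = CARD('k::finite) + 1 \<longrightarrow>
      has_principal_curvatures TYPE('k) (ellipsoid_sum A m) (boundary_point A m n) n
        (image_mset inverse (filter_mset (\<lambda>c. 0 < c) (eigenvalues (curvature_matrix A m n)))))"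
proof (intro ballI conjI impI)
  interpret ellipsoids A m using assms by unfold_locales
  fix n :: "real^'n" assume "n \<in> sphere 0 1"
  then have n: "norm n = 1" "n \<noteq> 0" by auto
  show "positive_semidefinite (curvature_matrix A m n)" by (rule C_positive_semidefinite)
  show "rank (curvature_matrix A m n) = CARD('n) - 1" using n by (intro C_rank)
  show "boundary_point A m n \<in> frontier (ellipsoid_sum A m)" using n by (intro grad_frontier)
  assume "CARD('n) = CARD('k) + 1"
  then obtain b and ev :: "'k \<Rightarrow> real" where "normal_frame A m n b ev"
    using normal_frame_exists[OF n(1)] by blast
  then show "has_principal_curvatures TYPE('k) (ellipsoid_sum A m) (boundary_point A m n) n
    (image_mset inverse (filter_mset (\<lambda>c. 0 < c) (eigenvalues (curvature_matrix A m n))))"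
    by (rule normal_frame.principal_curvatures)
qed

end
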